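(* Let $n\ge 2$ and let $G\subset\mathbb{R}^n$ be a non-empty open set with non-empty boundary. Assume that $1\le p<n$ and $\beta\in\mathbb{R}$. If $G$ admits a $(p,p,\beta)$-Hardy--Sobolev inequality (i.e., a $(p,\beta)$-Hardy inequality), then $G$ admits $(q,p,\beta)$-Hardy--Sobolev inequalities for all exponents $p\le q\le p^*=np/(n-p)$.
   Context: $\delta_{\partial G}(x)=\operatorname{dist}(x,\partial G)$, and $C_0^\infty(G)$ denotes smooth functions with compact support in $G$. An open set $G$ admits a $(q,p,\beta)$-Hardy--Sobolev inequality if there is a constant $C>0$ such that $$\biggl(\int_{G} |f|^q \,\delta_{\partial G}^{(q/p)(n-p+\beta)-n}\,dx\biggr)^{1/q}\le C \biggl(\int_G |\nabla f|^p\,\delta_{\partial G}^{\beta}\,dx\biggr)^{1/p}$$ for all $f\in C_0^\infty(G)$. For $q=p$ this is the $(p,\beta)$-Hardy inequality, with weight $\delta_{\partial G}^{\beta-p}$ on the left-hand side. *)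

theory Defs
  imports "HOL-Analysis.Analysis"
begin

definition partial_deriv :: "'n::finite \<Rightarrow> (real ^ 'n \<Rightarrow> real) \<Rightarrow> real ^ 'n \<Rightarrow> real" where
  "partial_deriv i f x = frechet_derivative f (at x) (axis i 1)"

definition gradient :: "(real ^ 'n \<Rightarrow> real) \<Rightarrow> real ^ 'n \<Rightarrow> real ^ ('n::finite)" where
  "gradient f x = (\<chi> i. partial_deriv i f x)"

fun C_k :: "nat \<Rightarrow> (real ^ 'n::finite \<Rightarrow> real) \<Rightarrow> bool" where
  "C_k 0 f \<longleftrightarrow> continuous_on UNIV f"
| "C_k (Suc k) f \<longleftrightarrow> f differentiable_on UNIV \<and> (\<forall>i. C_k k (partial_deriv i f))"

text \<open>Elements of \<open>C\<^sub>0\<^sup>\<infinity>(G)\<close> are represented by their extensions by zero to the whole space, which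
  are smooth everywhere because the support is a compact subset of the open set \<open>G\<close>.\<close>

definition test_functions :: "(real ^ 'n::finite) set \<Rightarrow> (real ^ 'n \<Rightarrow> real) set" where
  "test_functions G =
     {f. (\<forall>k. C_k k f) \<and> compact (closure {x. f x \<noteq> 0}) \<and> closure {x. f x \<noteq> 0} \<subseteq> G}"

definition bdist :: "(real ^ 'n::finite) set \<Rightarrow> real ^ 'n \<Rightarrow> real" where
  "bdist G x = infdist x (frontier G)"

text \<open>The following is meant for open \<open>G\<close> with non-empty boundary (\<^const>\<open>infdist\<close> to the empty set
  is \<open>0\<close> by convention). Then \<open>bdist G > 0\<close> on \<open>G\<close>, and for \<open>p, q \<ge> 1\<close> both integrands are continuous
  on \<open>G\<close> with compact support there, so that the Bochner integrals exist.\<close>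

definition hardy_sobolev :: "(real ^ 'n::finite) set \<Rightarrow> real \<Rightarrow> real \<Rightarrow> real \<Rightarrow> bool" where
  "hardy_sobolev G q p \<beta> \<longleftrightarrow>
     (\<exists>C>0. \<forall>f\<in>test_functions G.
        (LINT x:G|lborel. \<bar>f x\<bar> powr q *
           bdist G x powr ((q / p) * (real CARD('n) - p + \<beta>) - real CARD('n))) powr (1 / q)
        \<le> C * (LINT x:G|lborel. norm (gradient f x) powr p * bdist G x powr \<beta>) powr (1 / p))"

end

theory Submission
  imports Defs
begin

text \<open>
  Let \<open>n\<close> be the dimension, \<open>d\<close> the distance to the boundary and \<open>r = np/(n - p)\<close>. The weight on the
  left-hand side is arranged so that at the critical exponent \<open>q = r\<close> it equals \<open>d\<close> to the power
  \<open>r\<beta>/p\<close>; the left-hand side is therefore the unweighted \<open>L\<^sup>r\<close> norm of \<open>u = \<bar>f\<bar> d\<^bsup>\<beta>/p\<^esup>\<close>. The classical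
  Sobolev inequality bounds this norm by the \<open>L\<^sup>p\<close> norm of the gradient of \<open>u\<close>. By the product rule
  and because \<open>d\<close> is 1-Lipschitz, that gradient is at most
  \<open>\<bar>\<nabla>f\<bar> d\<^bsup>\<beta>/p\<^esup> + \<bar>\<beta>/p\<bar> \<bar>f\<bar> d\<^bsup>\<beta>/p - 1\<^esup>\<close>. The \<open>p\<close>-th power of the first term integrates to
  the right-hand side, and that of the second to a multiple of the left-hand side of the Hardy
  inequality. This is \<open>hardy_sobolev_critical\<close>. For \<open>p \<le> q \<le> r\<close> the exponents of both \<open>\<bar>f\<bar>\<close> and
  \<open>d\<close> are affine in \<open>q\<close>, so Hoelder's inequality interpolates between the two endpoints
  (\<open>hardy_sobolev_interpolation\<close>).

  The function \<open>u\<close> is only locally Lipschitz. Rather than differentiate it almost everywhere,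
  the proof uses pointwise upper bounds for its difference quotients (\<open>slope_le\<close>). They obey the
  usual product and chain rules, and a continuous bound controls increments along lines by its
  integral. This is all that the Gagliardo--Nirenberg proof of the Sobolev inequality needs: \<open>u x\<close> is
  at most the integral of the slope bound \<open>h\<close> over each of the \<open>n\<close> coordinate lines through \<open>x\<close>, and
  the product of the \<open>n\<close> line integrals of \<open>h\<close> is integrated with Hoelder's inequality, one
  coordinate at a time (\<open>Gagliardo\<close>). This gives the case \<open>p = 1\<close>; the general case follows on
  replacing \<open>u\<close> by a power of it.
\<close>

section \<open>Powers in \<open>[0, \<infinity>]\<close> and Hoelder's inequality\<close>

text \<open>
  Jensen's inequality for \<open>exp\<close> at the points \<open>ln (x i)\<close>; if some \<open>x i\<close> vanishes, so does the left-hand side.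
\<close>

lemma weighted_arith_geom_mean:
  fixes x a :: "'i \<Rightarrow> real"
  assumes S: "finite S" and a: "\<And>i. i \<in> S \<Longrightarrow> a i > 0" and "(\<Sum>i\<in>S. a i) = 1"
    and x: "\<And>i. i \<in> S \<Longrightarrow> x i \<ge> 0"
  shows "(\<Prod>i\<in>S. x i powr a i) \<le> (\<Sum>i\<in>S. a i * x i)"
proof (cases "\<exists>i\<in>S. x i = 0")
  case True
  then have "(\<Prod>i\<in>S. x i powr a i) = 0"
    using S a by (auto simp: prod_zero_iff)
  then show ?thesis
    using a x by (simp add: less_imp_le sum_nonneg)
next
  case False
  then have pos: "x i > 0" if "i \<in> S" for i
    using x that by (force simp: less_le)
  have "(\<Prod>i\<in>S. x i powr a i) = exp (\<Sum>i\<in>S. a i *\<^sub>R ln (x i))"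
    using S pos by (simp add: exp_sum powr_def less_imp_neq[symmetric])
  also have "\<dots> \<le> (\<Sum>i\<in>S. a i * exp (ln (x i)))"
    using assms by (intro convex_on_sum[OF _ _ exp_convex]) (auto simp: less_imp_le)
  also have "\<dots> = (\<Sum>i\<in>S. a i * x i)"
    using pos by (intro sum.cong) auto
  finally show ?thesis .
qed

text \<open>
  The power \<open>x\<^sup>a\<close> on \<open>[0, \<infinity>]\<close> for \<open>a \<ge> 0\<close>. The value at \<open>a = 0\<close> is \<open>1\<close> for every base, \<open>0\<close> and
  \<open>\<infinity>\<close> included, so that a factor with exponent \<open>0\<close> can be dropped from a product. (For reals,
  \<open>0 powr 0 = 0\<close>.)
\<close>

definition epow :: "ennreal \<Rightarrow> real \<Rightarrow> ennreal" where
  "epow x a = (if a = 0 then 1 else if x = top then top else ennreal (enn2real x powr a))"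

lemma epow_0_right [simp]: "epow x 0 = 1"
  by (simp add: epow_def)

lemma epow_top [simp]: "a \<noteq> 0 \<Longrightarrow> epow top a = top"
  by (simp add: epow_def)

lemma epow_ennreal: "x \<ge> 0 \<Longrightarrow> a \<noteq> 0 \<Longrightarrow> epow (ennreal x) a = ennreal (x powr a)"
  by (simp add: epow_def)

lemma epow_eq_0_iff [simp]: "epow x a = 0 \<longleftrightarrow> a \<noteq> 0 \<and> x = 0"
  by (cases x) (auto simp: epow_def)

lemma epow_measurable [measurable]:
  assumes [measurable]: "f \<in> borel_measurable M"
  shows "(\<lambda>x. epow (f x) a) \<in> borel_measurable M"
  unfolding epow_def by measurable

lemma epow_mono:
  assumes "x \<le> y" "a \<ge> 0"
  shows "epow x a \<le> epow y a"
proof (cases "a = 0 \<or> y = top")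
  case False
  then obtain r where r: "y = ennreal r" "r \<ge> 0"
    by (cases y) auto
  with assms(1) obtain s where "x = ennreal s" "s \<ge> 0"
    by (cases x) (auto simp: top_unique)
  with r assms False show ?thesis
    by (auto simp: epow_def intro!: ennreal_leI powr_mono2)
qed (auto simp: epow_def)

lemma epow_add:
  assumes "a \<ge> 0" "b \<ge> 0"
  shows "epow x (a + b) = epow x a * epow x b"
proof (cases "a = 0 \<or> b = 0")
  case False
  with assms have "a > 0" "b > 0" by auto
  then show ?thesis
    by (cases x) (auto simp: epow_def powr_add ennreal_mult ennreal_top_mult)
qed auto

lemma epow_mult_ennreal:
  assumes "c > 0" "a > 0"
  shows "epow (x * ennreal c) a = epow x a * epow (ennreal c) a"
proof (cases x)
  case (real r)
  then show ?thesis
    using assms by (simp add: ennreal_mult[symmetric] epow_ennreal powr_mult)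
next
  case top
  then show ?thesis
    using assms by (simp add: ennreal_top_mult epow_ennreal)
qed

lemma prod_mono_ennreal:
  fixes f g :: "'i \<Rightarrow> ennreal"
  assumes "\<And>i. i \<in> A \<Longrightarrow> f i \<le> g i"
  shows "(\<Prod>i\<in>A. f i) \<le> (\<Prod>i\<in>A. g i)"
  using assms by (induction A rule: infinite_finite_induct) (auto intro: mult_mono)

lemma epow_prod_le_sum:
  assumes S: "finite S" and a: "\<And>i. i \<in> S \<Longrightarrow> a i > 0" and sum: "(\<Sum>i\<in>S. a i) = 1"
  shows "(\<Prod>i\<in>S. epow (x i) (a i)) \<le> (\<Sum>i\<in>S. ennreal (a i) * x i)"
proof (cases "\<exists>i\<in>S. x i = top")
  case True
  then obtain j where j: "j \<in> S" "x j = top" by auto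
  then have "ennreal (a j) * x j = top"
    using a[of j] by (simp add: ennreal_mult_top)
  then have "(\<Sum>i\<in>S. ennreal (a i) * x i) = top"
    using S j(1) by (subst sum.remove[of S j]) auto
  then show ?thesis by simp
next
  case False
  have x: "x i = ennreal (enn2real (x i))" if "i \<in> S" for i
    using False that by (auto simp: less_top)
  have "(\<Prod>i\<in>S. epow (x i) (a i)) = (\<Prod>i\<in>S. ennreal (enn2real (x i) powr a i))"
    using False a by (intro prod.cong refl) (force simp: epow_def)
  also have "\<dots> = ennreal (\<Prod>i\<in>S. enn2real (x i) powr a i)"
    by (simp add: prod_ennreal)
  also have "\<dots> \<le> ennreal (\<Sum>i\<in>S. a i * enn2real (x i))"
    using assms by (intro ennreal_leI weighted_arith_geom_mean) auto
  also have "\<dots> = (\<Sum>i\<in>S. ennreal (a i * enn2real (x i)))"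
    using a by (simp add: sum_ennreal less_imp_le)
  also have "\<dots> = (\<Sum>i\<in>S. ennreal (a i) * x i)"
    using a x by (intro sum.cong) (auto simp: ennreal_mult less_imp_le)
  finally show ?thesis .
qed

text \<open>
  Normalise each \<open>f i\<close> to integral \<open>1\<close> and integrate the weighted inequality between geometric and
  arithmetic mean. Normalisation is impossible if an integral is \<open>0\<close>, when the left-hand side vanishes, or
  else if one is \<open>\<infinity>\<close>, when the right-hand side is \<open>\<infinity>\<close>.
\<close>

lemma nn_integral_Holder_pos:
  assumes S: "finite S" and a: "\<And>i. i \<in> S \<Longrightarrow> a i > 0" and sum: "(\<Sum>i\<in>S. a i) = 1"
    and f [measurable]: "\<And>i. i \<in> S \<Longrightarrow> f i \<in> borel_measurable M"
  shows "(\<integral>\<^sup>+x. (\<Prod>i\<in>S. epow (f i x) (a i)) \<partial>M) \<le> (\<Prod>i\<in>S. epow (\<integral>\<^sup>+x. f i x \<partial>M) (a i))"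
proof -
  consider (zero) j where "j \<in> S" "(\<integral>\<^sup>+x. f j x \<partial>M) = 0"
    | (top) j where "j \<in> S" "(\<integral>\<^sup>+x. f j x \<partial>M) = top" "\<And>i. i \<in> S \<Longrightarrow> (\<integral>\<^sup>+x. f i x \<partial>M) \<noteq> 0"
    | (pos) "\<And>i. i \<in> S \<Longrightarrow> (\<integral>\<^sup>+x. f i x \<partial>M) \<noteq> 0 \<and> (\<integral>\<^sup>+x. f i x \<partial>M) \<noteq> top"
    by blast
  then show ?thesis
  proof cases
    case zero
    then have "AE x in M. f j x = 0"
      using f by (simp add: nn_integral_0_iff_AE)
    then have "AE x in M. (\<Prod>i\<in>S. epow (f i x) (a i)) = 0"
    proof eventually_elim
      case (elim x)
      then show ?case
        using zero S a[of j] by (intro prod_zero) (auto intro!: bexI[of _ j])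
    qed
    then have "(\<integral>\<^sup>+x. (\<Prod>i\<in>S. epow (f i x) (a i)) \<partial>M) = 0"
      by (subst nn_integral_0_iff_AE) auto
    then show ?thesis by simp
  next
    case top
    have "(\<Prod>i\<in>S. epow (\<integral>\<^sup>+x. f i x \<partial>M) (a i)) = top"
      using top S a[of j] by (subst prod.remove[of S j]) (auto simp: ennreal_top_mult)
    then show ?thesis by simp
  next
    case pos
    define c where "c i = enn2real (\<integral>\<^sup>+x. f i x \<partial>M)" for i
    have c: "(\<integral>\<^sup>+x. f i x \<partial>M) = ennreal (c i)" "c i > 0" if "i \<in> S" for i
      using pos[OF that] by (auto simp: c_def enn2real_positive_iff less_top zero_less_iff_neq_zero)
    define g where "g i x = f i x * ennreal (1 / c i)" for i x
    have fg: "f i x = g i x * ennreal (c i)" if "i \<in> S" for i x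
      using c(2)[OF that] by (simp add: g_def mult.assoc ennreal_mult[symmetric])
    have g [measurable]: "g i \<in> borel_measurable M" if "i \<in> S" for i
      using that unfolding g_def by measurable
    have g1: "(\<integral>\<^sup>+x. g i x \<partial>M) = 1" if "i \<in> S" for i
      using c[OF that] that by (simp add: g_def nn_integral_multc ennreal_mult[symmetric])
    have "(\<integral>\<^sup>+x. (\<Prod>i\<in>S. epow (f i x) (a i)) \<partial>M)
        = (\<integral>\<^sup>+x. (\<Prod>i\<in>S. epow (g i x) (a i)) * (\<Prod>i\<in>S. epow (ennreal (c i)) (a i)) \<partial>M)"
      using c a by (intro nn_integral_cong) (simp add: fg epow_mult_ennreal prod.distrib)
    also have "\<dots> = (\<integral>\<^sup>+x. (\<Prod>i\<in>S. epow (g i x) (a i)) \<partial>M) * (\<Prod>i\<in>S. epow (ennreal (c i)) (a i))"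
      by (intro nn_integral_multc) measurable
    also have "(\<integral>\<^sup>+x. (\<Prod>i\<in>S. epow (g i x) (a i)) \<partial>M) \<le> (\<integral>\<^sup>+x. (\<Sum>i\<in>S. ennreal (a i) * g i x) \<partial>M)"
      using assms by (intro nn_integral_mono epow_prod_le_sum) auto
    also have "\<dots> = (\<Sum>i\<in>S. ennreal (a i) * (\<integral>\<^sup>+x. g i x \<partial>M))"
      by (subst nn_integral_sum) (auto simp: nn_integral_cmult)
    also have "\<dots> = (\<Sum>i\<in>S. ennreal (a i))"
      by (intro sum.cong) (auto simp: g1)
    also have "\<dots> = 1"
      using a sum by (simp add: sum_ennreal less_imp_le)
    finally show ?thesis
      using c by (simp add: mult_right_mono)
  qed
qed

lemma nn_integral_Holder:
  assumes S: "finite S" and a: "\<And>i. i \<in> S \<Longrightarrow> a i \<ge> 0" and sum: "(\<Sum>i\<in>S. a i) = 1"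
    and f: "\<And>i. i \<in> S \<Longrightarrow> f i \<in> borel_measurable M"
  shows "(\<integral>\<^sup>+x. (\<Prod>i\<in>S. epow (f i x) (a i)) \<partial>M) \<le> (\<Prod>i\<in>S. epow (\<integral>\<^sup>+x. f i x \<partial>M) (a i))"
proof -
  define T where "T = {i\<in>S. a i > 0}"
  have T: "finite T" "T \<subseteq> S" and a0: "\<And>i. i \<in> S - T \<Longrightarrow> a i = 0"
    using S a by (auto simp: T_def less_le)
  have drop: "(\<Prod>i\<in>S. epow (y i) (a i)) = (\<Prod>i\<in>T. epow (y i) (a i))" for y
    using S T a0 by (intro prod.mono_neutral_right) auto
  have "(\<Sum>i\<in>T. a i) = 1"
    using sum S T a0 by (subst (asm) sum.mono_neutral_right[of S T]) auto
  then show ?thesis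
    unfolding drop using T f by (intro nn_integral_Holder_pos) (auto simp: T_def)
qed

text \<open>
  The case of two real functions. It is stated with the integrands on the inside of the powers because
  both uses below split a given integrand into powers of two others.
\<close>

lemma integral_Holder:
  fixes f g :: "'a \<Rightarrow> real"
  assumes f: "integrable M f" "\<And>x. f x \<ge> 0" and g: "integrable M g" "\<And>x. g x \<ge> 0"
    and ab: "a > 0" "b > 0" "a + b = 1"
  shows "(\<integral>x. f x powr a * g x powr b \<partial>M) \<le> (\<integral>x. f x \<partial>M) powr a * (\<integral>x. g x \<partial>M) powr b"
proof -
  have [measurable]: "f \<in> borel_measurable M" "g \<in> borel_measurable M"
    using f g by auto
  have "(\<integral>\<^sup>+x. ennreal (f x powr a * g x powr b) \<partial>M)
      = (\<integral>\<^sup>+x. (\<Prod>i\<in>UNIV. epow (ennreal (if i then f x else g x)) (if i then a else b)) \<partial>M)"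
    using ab f g by (intro nn_integral_cong) (simp add: UNIV_bool epow_ennreal ennreal_mult mult.commute)
  also have "\<dots> \<le> (\<Prod>i\<in>UNIV. epow (\<integral>\<^sup>+x. ennreal (if i then f x else g x) \<partial>M) (if i then a else b))"
    using ab by (intro nn_integral_Holder) (auto simp: UNIV_bool)
  also have "\<dots> = ennreal ((\<integral>x. f x \<partial>M) powr a * (\<integral>x. g x \<partial>M) powr b)"
    using ab f g by (simp add: UNIV_bool nn_integral_eq_integral epow_ennreal ennreal_mult mult.commute)
  finally show ?thesis
    by (subst integral_eq_nn_integral) (auto intro!: enn2real_leI)
qed

section \<open>Partial integrals and Gagliardo's inequality\<close>

text \<open>
  The point \<open>x\<close> with its coordinates in \<open>J\<close> replaced by those of \<open>y\<close>. Iterated integrals are taken over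
  functions of the whole space that happen to be constant in the coordinates already integrated, so
  that no space of lower dimension is involved.
\<close>

definition slice :: "'a set \<Rightarrow> 'a::euclidean_space \<Rightarrow> ('a \<Rightarrow> real) \<Rightarrow> 'a" where
  "slice J x y = (\<Sum>b\<in>Basis. (if b \<in> J then y b else x \<bullet> b) *\<^sub>R b)"

definition partial_integral :: "'a::euclidean_space set \<Rightarrow> ('a \<Rightarrow> ennreal) \<Rightarrow> 'a \<Rightarrow> ennreal" where
  "partial_integral J h x = (\<integral>\<^sup>+ y. h (slice J x y) \<partial>(\<Pi>\<^sub>M b\<in>J. lborel))"

abbreviation line :: "'a::euclidean_space \<Rightarrow> 'a \<Rightarrow> real \<Rightarrow> 'a" where
  "line j x t \<equiv> slice {j} x (\<lambda>_. t)"

interpretation lborel_product: product_sigma_finite "\<lambda>b::'a::euclidean_space. lborel :: real measure"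
  by standard

lemma slice_inner: "b \<in> Basis \<Longrightarrow> slice J x y \<bullet> b = (if b \<in> J then y b else x \<bullet> b)"
  by (simp add: slice_def inner_sum_left_Basis)

lemma slice_fun_upd:
  "slice (insert j J) x (y(j := t)) = slice J (line j x t) y" if "j \<notin> J"
  by (rule euclidean_eqI) (use that in \<open>auto simp: slice_inner\<close>)

lemma slice_measurable [measurable]:
  fixes f :: "'m \<Rightarrow> 'a::euclidean_space"
  assumes f: "f \<in> borel_measurable M" and g: "g \<in> measurable M (\<Pi>\<^sub>M b\<in>J. lborel)"
  shows "(\<lambda>z. slice J (f z) (g z)) \<in> borel_measurable M"
proof (subst borel_measurable_euclidean_space, intro ballI)
  fix b :: 'a assume b: "b \<in> Basis"
  have "(\<lambda>z. f z \<bullet> b) \<in> borel_measurable M"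
    using f by simp
  moreover have "(\<lambda>z. g z b) \<in> borel_measurable M" if "b \<in> J"
    using measurable_compose[OF g measurable_component_singleton[OF that]] by simp
  ultimately show "(\<lambda>z. slice J (f z) (g z) \<bullet> b) \<in> borel_measurable M"
    using b by (cases "b \<in> J") (simp_all add: slice_inner)
qed

lemma line_measurable [measurable]:
  fixes x :: "'a::euclidean_space"
  shows "line j x \<in> borel_measurable borel"
proof (subst borel_measurable_euclidean_space, intro ballI)
  fix b :: 'a assume b: "b \<in> Basis"
  show "(\<lambda>t. line j x t \<bullet> b) \<in> borel_measurable borel"
    using b by (cases "b = j") (simp_all add: slice_inner)
qed

lemma partial_integral_empty [simp]: "partial_integral {} h x = h x"
  unfolding partial_integral_def
  by (subst lborel_product.nn_integral_empty) (simp_all add: slice_def euclidean_representation)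

lemma partial_integral_Basis:
  assumes [measurable]: "h \<in> borel_measurable borel"
  shows "partial_integral Basis h x = (\<integral>\<^sup>+ z. h z \<partial>lborel)"
proof -
  have "(\<integral>\<^sup>+ z. h z \<partial>lborel) = (\<integral>\<^sup>+ y. h (\<Sum>b\<in>Basis. y b *\<^sub>R b) \<partial>(\<Pi>\<^sub>M b\<in>Basis. lborel))"
    by (subst lborel_eq) (simp add: nn_integral_distr)
  also have "\<dots> = partial_integral Basis h x"
    unfolding partial_integral_def slice_def
    by (intro nn_integral_cong arg_cong[of _ _ h] sum.cong refl) simp
  finally show ?thesis ..
qed

lemma partial_integral_measurable [measurable]:
  assumes h: "h \<in> borel_measurable borel" and J: "finite J"
  shows "partial_integral J h \<in> borel_measurable borel"
proof -
  interpret finite_product_sigma_finite "\<lambda>b. lborel :: real measure" J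
    by standard (rule J)
  have "(\<lambda>z. slice J (fst z) (snd z)) \<in> borel_measurable (borel \<Otimes>\<^sub>M (\<Pi>\<^sub>M b\<in>J. lborel))"
    by (intro slice_measurable) simp_all
  from measurable_compose[OF this h]
  have "(\<lambda>(x, y). h (slice J x y)) \<in> borel_measurable (borel \<Otimes>\<^sub>M (\<Pi>\<^sub>M b\<in>J. lborel))"
    by (simp add: case_prod_beta)
  then show ?thesis
    unfolding partial_integral_def by (rule borel_measurable_nn_integral)
qed

lemma partial_integral_insert:
  assumes h: "h \<in> borel_measurable borel" and J: "finite J" "j \<notin> J"
  shows "partial_integral (insert j J) h x = (\<integral>\<^sup>+ t. partial_integral J h (line j x t) \<partial>lborel)"
proof -
  have "(\<lambda>y. h (slice (insert j J) x y)) \<in> borel_measurable (\<Pi>\<^sub>M b\<in>insert j J. lborel)"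
    by (intro measurable_compose[OF _ h] slice_measurable) simp_all
  from lborel_product.product_nn_integral_insert_rev[OF J this]
  show ?thesis
    unfolding partial_integral_def slice_fun_upd[OF J(2)] .
qed

lemma partial_integral_line:
  assumes "j \<in> J"
  shows "partial_integral J h (line j x t) = partial_integral J h x"
proof -
  have "slice J (line j x t) y = slice J x y" for y
    by (rule euclidean_eqI) (use assms in \<open>auto simp: slice_inner\<close>)
  then show ?thesis by (simp only: partial_integral_def)
qed

text \<open>
  Integration in one further coordinate \<open>j\<close> of the bound that \<open>Gagliardo\<close> carries along. The factor
  with index \<open>j\<close> is already constant in that direction and comes out of the integral. The
  exponents of the remaining factors add up to
  \<open>card J / (n - 1) + (n - 1 - card J) / (n - 1) = 1\<close>, so Hoelder's inequality applies to them. Each of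
  their integrals is a partial integral over one more coordinate.
\<close>

lemma line_integral_Holder_step:
  fixes h :: "'a::euclidean_space \<Rightarrow> ennreal"
  defines "n \<equiv> real DIM('a)"
  assumes [measurable]: "h \<in> borel_measurable borel" and J: "J \<subseteq> Basis" "j \<in> Basis - J" and "n > 1"
  shows "(\<integral>\<^sup>+ t. epow (partial_integral J h (line j x t)) (real (card J) / (n - 1)) *
          (\<Prod>b\<in>Basis - J. epow (partial_integral (insert b J) h (line j x t)) (1 / (n - 1))) \<partial>lborel)
      \<le> epow (partial_integral (insert j J) h x) (real (card (insert j J)) / (n - 1)) *
          (\<Prod>b\<in>Basis - insert j J. epow (partial_integral (insert b (insert j J)) h x) (1 / (n - 1)))"
proof -
  define R where "R = Basis - insert j J"
  have fin: "finite J" "finite R" and R: "j \<notin> R" "Basis - J = insert j R"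
    using J finite_subset[OF J(1)] by (auto simp: R_def)
  \<comment> \<open>The factors left under the integral: \<open>None\<close> stands for the one with exponent \<open>card J / (n - 1)\<close>.\<close>
  define G where "G k = (case k of None \<Rightarrow> partial_integral J h | Some b \<Rightarrow> partial_integral (insert b J) h)"
    for k
  define a where "a k = (case k of None \<Rightarrow> real (card J) / (n - 1) | Some b \<Rightarrow> 1 / (n - 1))" for k :: "'a option"
  have cR: "real (card R) = n - 1 - card J"
  proof -
    have "card (Basis :: 'a set) = card (insert j R) + card J"
      using card_Diff_subset[OF fin(1) J(1)] card_mono[OF finite_Basis J(1)] R(2) by simp
    then show ?thesis using R fin by (simp add: n_def)
  qed
  have prodS: "(\<Prod>k\<in>insert None (Some ` R). F k) = F None * (\<Prod>b\<in>R. F (Some b))" for F :: "_ \<Rightarrow> ennreal"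
    using fin by (subst prod.insert) (auto simp: prod.reindex)
  have sum1: "(\<Sum>k\<in>insert None (Some ` R). a k) = 1"
  proof -
    have "(\<Sum>k\<in>insert None (Some ` R). a k) = real (card J) / (n - 1) + real (card R) / (n - 1)"
      using fin by (subst sum.insert) (auto simp: sum.reindex a_def)
    also have "\<dots> = 1"
      using \<open>n > 1\<close> cR by (simp add: add_divide_distrib[symmetric])
    finally show ?thesis .
  qed
  have G [measurable]: "G k \<in> borel_measurable borel" for k
    using fin by (cases k) (auto simp: G_def)
  have Gline: "(\<lambda>t. G k (line j x t)) \<in> borel_measurable lborel" for k
    using measurable_compose[OF line_measurable G] by simp
  let ?c = "epow (partial_integral (insert j J) h x) (1 / (n - 1))"
  have "(\<integral>\<^sup>+ t. epow (partial_integral J h (line j x t)) (real (card J) / (n - 1)) *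
          (\<Prod>b\<in>Basis - J. epow (partial_integral (insert b J) h (line j x t)) (1 / (n - 1))) \<partial>lborel)
      = (\<integral>\<^sup>+ t. ?c * (\<Prod>k\<in>insert None (Some ` R). epow (G k (line j x t)) (a k)) \<partial>lborel)"
    using fin R unfolding prodS
    by (intro nn_integral_cong) (simp add: partial_integral_line G_def a_def mult_ac)
  also have "\<dots> = ?c * (\<integral>\<^sup>+ t. (\<Prod>k\<in>insert None (Some ` R). epow (G k (line j x t)) (a k)) \<partial>lborel)"
    using Gline by (intro nn_integral_cmult borel_measurable_prod epow_measurable) simp
  also have "\<dots> \<le> ?c * (\<Prod>k\<in>insert None (Some ` R). epow (\<integral>\<^sup>+ t. G k (line j x t) \<partial>lborel) (a k))"
  proof (rule mult_left_mono[OF nn_integral_Holder])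
    show "a k \<ge> 0" for k
      using \<open>n > 1\<close> by (simp add: a_def split: option.split)
  qed (use fin sum1 Gline in auto)
  also have "(\<Prod>k\<in>insert None (Some ` R). epow (\<integral>\<^sup>+ t. G k (line j x t) \<partial>lborel) (a k))
      = epow (partial_integral (insert j J) h x) (real (card J) / (n - 1)) *
        (\<Prod>b\<in>R. epow (partial_integral (insert j (insert b J)) h x) (1 / (n - 1)))"
  proof -
    have "(\<integral>\<^sup>+ t. G None (line j x t) \<partial>lborel) = partial_integral (insert j J) h x"
      using fin J by (simp add: G_def partial_integral_insert)
    moreover have "(\<integral>\<^sup>+ t. G (Some b) (line j x t) \<partial>lborel) = partial_integral (insert j (insert b J)) h x"
      if "b \<in> R" for b
      using fin J R that by (subst partial_integral_insert) (auto simp: G_def)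
    ultimately show ?thesis
      by (simp add: prodS a_def)
  qed
  also have "?c * \<dots>
      = ?c * epow (partial_integral (insert j J) h x) (real (card J) / (n - 1)) *
        (\<Prod>b\<in>R. epow (partial_integral (insert j (insert b J)) h x) (1 / (n - 1)))"
    by (simp add: mult.assoc)
  also have "\<dots> = epow (partial_integral (insert j J) h x) (1 / (n - 1) + real (card J) / (n - 1)) *
      (\<Prod>b\<in>R. epow (partial_integral (insert j (insert b J)) h x) (1 / (n - 1)))"
    using \<open>n > 1\<close> by (simp add: epow_add)
  also have "1 / (n - 1) + real (card J) / (n - 1) = real (card (insert j J)) / (n - 1)"
    using fin J by (simp add: add_divide_distrib)
  finally show ?thesis
    by (simp add: R_def insert_commute)
qed

text \<open>
  By induction on the set \<open>J\<close> of coordinates over which the product of the line integrals has been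
  integrated: the result is at most \<open>h\<^sub>J\<^bsup>card J / (n - 1)\<^esup>\<close> times the product over \<open>b \<notin> J\<close> of
  \<open>h\<^bsub>insert b J\<^esub>\<^bsup>1 / (n - 1)\<^esup>\<close>, where \<open>h\<^sub>J\<close> is the partial integral of \<open>h\<close> over \<open>J\<close>. For \<open>J = Basis\<close>
  only the first factor is left.
\<close>

lemma Gagliardo:
  fixes h :: "'a::euclidean_space \<Rightarrow> ennreal"
  defines "n \<equiv> real DIM('a)"
  assumes h [measurable]: "h \<in> borel_measurable borel" and "n > 1"
  shows "(\<integral>\<^sup>+ x. (\<Prod>b\<in>Basis. epow (\<integral>\<^sup>+ t. h (line b x t) \<partial>lborel) (1 / (n - 1))) \<partial>lborel)
      \<le> epow (\<integral>\<^sup>+ x. h x \<partial>lborel) (n / (n - 1))"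
proof -
  let ?P = "\<lambda>x. \<Prod>b\<in>Basis. epow (partial_integral {b} h x) (1 / (n - 1))"
  have P [measurable]: "?P \<in> borel_measurable borel"
    by measurable
  have step: "partial_integral J ?P x
      \<le> epow (partial_integral J h x) (real (card J) / (n - 1)) *
          (\<Prod>b\<in>Basis - J. epow (partial_integral (insert b J) h x) (1 / (n - 1)))"
    if "J \<subseteq> Basis" for J x
    using finite_subset[OF that finite_Basis] that
  proof (induction J arbitrary: x rule: finite_induct)
    case empty
    then show ?case by simp
  next
    case (insert j J)
    have "partial_integral (insert j J) ?P x = (\<integral>\<^sup>+ t. partial_integral J ?P (line j x t) \<partial>lborel)"
      using insert.hyps by (intro partial_integral_insert) auto
    also have "\<dots> \<le> (\<integral>\<^sup>+ t. epow (partial_integral J h (line j x t)) (real (card J) / (n - 1)) *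
          (\<Prod>b\<in>Basis - J. epow (partial_integral (insert b J) h (line j x t)) (1 / (n - 1))) \<partial>lborel)"
      using insert.prems by (intro nn_integral_mono insert.IH) auto
    also have "\<dots> \<le> epow (partial_integral (insert j J) h x) (real (card (insert j J)) / (n - 1)) *
          (\<Prod>b\<in>Basis - insert j J. epow (partial_integral (insert b (insert j J)) h x) (1 / (n - 1)))"
      using insert.prems insert.hyps \<open>n > 1\<close> unfolding n_def
      by (intro line_integral_Holder_step) auto
    finally show ?case .
  qed
  have "partial_integral {b} h x = (\<integral>\<^sup>+ t. h (line b x t) \<partial>lborel)" for b x
    by (subst partial_integral_insert) auto
  moreover have "(\<integral>\<^sup>+ x. ?P x \<partial>lborel) \<le> epow (\<integral>\<^sup>+ x. h x \<partial>lborel) (n / (n - 1))"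
    using step[OF subset_refl, of 0]
    unfolding partial_integral_Basis[OF P] partial_integral_Basis[OF h] by (simp add: n_def)
  ultimately show ?thesis by simp
qed

section \<open>Pointwise bounds for difference quotients\<close>

text \<open>
  An upper bound for the pointwise Lipschitz constant
  \<open>lim sup \<bar>u y - u x\<bar> / dist y x\<close> as \<open>y \<rightarrow> x\<close>. Writing the bound as the limit of a majorant \<open>R\<close> of the
  difference quotients turns the product and chain rules into limit laws for \<open>R\<close>.
\<close>

definition slope_le :: "('a::metric_space \<Rightarrow> real) \<Rightarrow> 'a \<Rightarrow> real \<Rightarrow> bool" where
  "slope_le u x c \<longleftrightarrow>
     (\<exists>R. (R \<longlongrightarrow> c) (at x) \<and> (\<forall>\<^sub>F y in at x. \<bar>u y - u x\<bar> \<le> R y * dist y x))"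

lemma slope_leI:
  assumes "(R \<longlongrightarrow> c) (at x)" "\<forall>\<^sub>F y in at x. \<bar>u y - u x\<bar> \<le> R y * dist y x"
  shows "slope_le u x c"
  using assms by (auto simp: slope_le_def)

lemma slope_le_imp_isCont:
  assumes "slope_le u x c"
  shows "isCont u x"
proof -
  obtain R where R: "(R \<longlongrightarrow> c) (at x)" "\<forall>\<^sub>F y in at x. \<bar>u y - u x\<bar> \<le> R y * dist y x"
    using assms by (auto simp: slope_le_def)
  have "((\<lambda>y. R y * dist y x) \<longlongrightarrow> c * dist x x) (at x)"
    by (intro tendsto_intros R)
  then have "((\<lambda>y. R y * dist y x) \<longlongrightarrow> 0) (at x)" by simp
  then have "((\<lambda>y. u y - u x) \<longlongrightarrow> 0) (at x)"
    by (rule Lim_null_comparison[rotated]) (use R(2) in simp)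
  then show ?thesis
    by (simp add: isCont_def LIM_zero_iff)
qed

lemma slope_le_Lipschitz:
  assumes "\<And>y. \<bar>u y - u x\<bar> \<le> L * dist y x"
  shows "slope_le u x L"
  by (rule slope_leI[of "\<lambda>_. L"]) (use assms in auto)

lemma slope_le_locally_0:
  assumes "\<forall>\<^sub>F y in nhds x. u y = 0"
  shows "slope_le u x 0"
proof (rule slope_leI[of "\<lambda>_. 0"])
  have "u x = 0" by (rule eventually_nhds_x_imp_x[OF assms])
  then show "\<forall>\<^sub>F y in at x. \<bar>u y - u x\<bar> \<le> 0 * dist y x"
    using assms by (auto simp: eventually_at_filter elim: eventually_mono)
qed simp

lemma slope_le_abs:
  assumes "slope_le u x c"
  shows "slope_le (\<lambda>y. \<bar>u y\<bar>) x c"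
proof -
  obtain R where R: "(R \<longlongrightarrow> c) (at x)" "\<forall>\<^sub>F y in at x. \<bar>u y - u x\<bar> \<le> R y * dist y x"
    using assms by (auto simp: slope_le_def)
  show ?thesis
    by (rule slope_leI[OF R(1)], use R(2) in eventually_elim) linarith
qed

lemma slope_le_has_derivative:
  fixes f :: "'a::real_normed_vector \<Rightarrow> real"
  assumes f: "(f has_derivative f') (at x)" and c: "\<And>v. \<bar>f' v\<bar> \<le> c * norm v"
  shows "slope_le f x c"
proof (rule slope_leI)
  show "((\<lambda>y. \<bar>f y - f x - f' (y - x)\<bar> / norm (y - x) + c) \<longlongrightarrow> c) (at x)"
  proof -
    have "((\<lambda>y. norm ((f y - f x - f' (y - x)) /\<^sub>R norm (y - x)) + c) \<longlongrightarrow> 0 + c) (at x)"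
      using f unfolding has_derivative_at_within by (intro tendsto_intros tendsto_norm_zero) auto
    then show ?thesis
      by (simp add: divide_inverse abs_mult mult.commute)
  qed
  have "\<bar>f y - f x\<bar> \<le> (\<bar>f y - f x - f' (y - x)\<bar> / norm (y - x) + c) * dist y x" if "y \<noteq> x" for y
  proof -
    have "\<bar>f y - f x\<bar> \<le> \<bar>f y - f x - f' (y - x)\<bar> + c * norm (y - x)"
      using c[of "y - x"] by linarith
    then show ?thesis
      using that by (simp add: dist_norm distrib_right)
  qed
  then show "\<forall>\<^sub>F y in at x. \<bar>f y - f x\<bar> \<le> (\<bar>f y - f x - f' (y - x)\<bar> / norm (y - x) + c) * dist y x"
    by (auto simp: eventually_at_filter)
qed

lemma slope_le_mult:
  assumes u: "slope_le u x c" and v: "slope_le v x d"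
  shows "slope_le (\<lambda>y. u y * v y) x (\<bar>u x\<bar> * d + \<bar>v x\<bar> * c)"
proof -
  obtain R where R: "(R \<longlongrightarrow> c) (at x)" "\<forall>\<^sub>F y in at x. \<bar>u y - u x\<bar> \<le> R y * dist y x"
    using u by (auto simp: slope_le_def)
  obtain S where S: "(S \<longlongrightarrow> d) (at x)" "\<forall>\<^sub>F y in at x. \<bar>v y - v x\<bar> \<le> S y * dist y x"
    using v by (auto simp: slope_le_def)
  have "(u \<longlongrightarrow> u x) (at x)"
    using slope_le_imp_isCont[OF u] by (simp add: isCont_def)
  then have lim: "((\<lambda>y. \<bar>u y\<bar> * S y + \<bar>v x\<bar> * R y) \<longlongrightarrow> \<bar>u x\<bar> * d + \<bar>v x\<bar> * c) (at x)"
    by (intro tendsto_intros R S)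
  show ?thesis
  proof (rule slope_leI[OF lim], use R(2) S(2) in eventually_elim)
    case (elim y)
    have "\<bar>u y * v y - u x * v x\<bar> = \<bar>u y * (v y - v x) + v x * (u y - u x)\<bar>"
      by (simp add: algebra_simps)
    also have "\<dots> \<le> \<bar>u y\<bar> * \<bar>v y - v x\<bar> + \<bar>v x\<bar> * \<bar>u y - u x\<bar>"
      by (metis abs_mult abs_triangle_ineq)
    also have "\<dots> \<le> \<bar>u y\<bar> * (S y * dist y x) + \<bar>v x\<bar> * (R y * dist y x)"
      using elim by (intro add_mono mult_left_mono) auto
    finally show ?case
      by (simp add: algebra_simps)
  qed
qed

lemma slope_le_compose_DERIV:
  assumes u: "slope_le u x c" and \<phi>: "DERIV \<phi> (u x) :> m"
  shows "slope_le (\<lambda>y. \<phi> (u y)) x (\<bar>m\<bar> * c)"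
proof -
  obtain R where R: "(R \<longlongrightarrow> c) (at x)" "\<forall>\<^sub>F y in at x. \<bar>u y - u x\<bar> \<le> R y * dist y x"
    using u by (auto simp: slope_le_def)
  obtain g where g: "\<And>z. \<phi> z - \<phi> (u x) = g z * (z - u x)" "isCont g (u x)" "g (u x) = m"
    using \<phi> by (auto simp: CARAT_DERIV)
  have "isCont (\<lambda>y. g (u y)) x"
    using slope_le_imp_isCont[OF u] g(2) by (rule isCont_o2)
  then have "((\<lambda>y. g (u y)) \<longlongrightarrow> m) (at x)"
    by (simp add: isCont_def g(3))
  then have lim: "((\<lambda>y. \<bar>g (u y)\<bar> * R y) \<longlongrightarrow> \<bar>m\<bar> * c) (at x)"
    by (intro tendsto_intros R)
  show ?thesis
    by (rule slope_leI[OF lim], use R(2) in eventually_elim)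
      (simp add: g(1) abs_mult mult.assoc mult_left_mono)
qed

text \<open>
  At the zeros of \<open>u\<close> the chain rule does not apply, since \<open>powr\<close> is differentiated at positive bases. There
  \<open>u y powr \<gamma> = u y powr (\<gamma> - 1) * u y\<close> has slope \<open>0\<close>, because \<open>\<gamma> > 1\<close> and \<open>u\<close> is continuous.
\<close>

lemma slope_le_powr:
  assumes u: "slope_le u x c" and pos: "\<And>y. u y \<ge> 0" and "\<gamma> > 1"
  shows "slope_le (\<lambda>y. u y powr \<gamma>) x (\<gamma> * u x powr (\<gamma> - 1) * c)"
proof (cases "u x = 0")
  case False
  then have "u x > 0" using pos[of x] by simp
  from slope_le_compose_DERIV[OF u has_real_derivative_powr[OF this, of \<gamma>]] \<open>\<gamma> > 1\<close>
  show ?thesis by simp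
next
  case True
  obtain R where R: "(R \<longlongrightarrow> c) (at x)" "\<forall>\<^sub>F y in at x. \<bar>u y - u x\<bar> \<le> R y * dist y x"
    using u by (auto simp: slope_le_def)
  have "(u \<longlongrightarrow> 0) (at x)"
    using slope_le_imp_isCont[OF u] True by (simp add: isCont_def)
  then have "((\<lambda>y. u y powr (\<gamma> - 1)) \<longlongrightarrow> 0) (at x)"
    using \<open>\<gamma> > 1\<close> pos by (intro tendsto_zero_powrI[where b = "\<gamma> - 1"]) auto
  from tendsto_mult[OF this R(1)]
  have lim: "((\<lambda>y. u y powr (\<gamma> - 1) * R y) \<longlongrightarrow> \<gamma> * u x powr (\<gamma> - 1) * c) (at x)"
    using True by simp
  show ?thesis
  proof (rule slope_leI[OF lim], use R(2) in eventually_elim)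
    case (elim y)
    have "u y powr \<gamma> = u y powr (\<gamma> - 1) * u y"
      using pos[of y] by (simp add: powr_mult_base[symmetric] powr_diff divide_simps)
    then show ?case
      using elim True pos[of y] by (simp add: mult.assoc mult_left_mono)
  qed
qed

text \<open>
  The substitute for the fundamental theorem of calculus. On short intervals around a point \<open>x\<close>,
  \<open>u\<close> changes at rate at most \<open>h x + e / 2\<close> away from \<open>x\<close>, and \<open>h\<close> stays above \<open>h x - e / 2\<close>; so
  the claim holds there with an error \<open>e\<close> times the length. Such a bound is additive over adjacent
  intervals, and bisection extends it to \<open>[a, b]\<close>.
\<close>

lemma slope_le_imp_increment_le_integral:
  fixes u h :: "real \<Rightarrow> real"
  assumes slope: "\<And>x. slope_le u x (h x)" and h: "continuous_on UNIV h" and "a \<le> b"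
  shows "\<bar>u b - u a\<bar> \<le> integral {a..b} h"
proof -
  have int: "h integrable_on {c..d}" for c d
    by (rule integrable_continuous_real) (rule continuous_on_subset[OF h], simp)
  have "\<bar>u b - u a\<bar> \<le> integral {a..b} h + e * (b - a)" if "e > 0" for e
    using \<open>a \<le> b\<close>
  proof (induction rule: Bolzano)
    case (trans c d f)
    then show ?case
      using Henstock_Kurzweil_Integration.integral_combine[OF trans(3,4) int]
      by (simp add: algebra_simps)
  next
    case (local x)
    obtain R where R: "(R \<longlongrightarrow> h x) (at x)" "\<forall>\<^sub>F y in at x. \<bar>u y - u x\<bar> \<le> R y * dist y x"
      using slope[of x] by (auto simp: slope_le_def)
    have "(h \<longlongrightarrow> h x) (at x)"
      using h by (simp add: continuous_on_def)
    then have "\<forall>\<^sub>F y in at x. dist (h y) (h x) < e / 2"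
      using \<open>e > 0\<close> by (intro tendstoD) auto
    moreover have "\<forall>\<^sub>F y in at x. dist (R y) (h x) < e / 2"
      using \<open>e > 0\<close> by (intro tendstoD R) auto
    ultimately have "\<forall>\<^sub>F y in at x. \<bar>u y - u x\<bar> \<le> (h x + e / 2) * \<bar>y - x\<bar> \<and> h x - e / 2 \<le> h y"
      using R(2)
    proof eventually_elim
      case (elim y)
      have "R y * \<bar>y - x\<bar> \<le> (h x + e / 2) * \<bar>y - x\<bar>"
        using elim unfolding dist_real_def by (intro mult_right_mono) linarith+
      then show ?case
        using elim unfolding dist_real_def by linarith
    qed
    then have "\<forall>\<^sub>F y in nhds x. \<bar>u y - u x\<bar> \<le> (h x + e / 2) * \<bar>y - x\<bar> \<and> h x - e / 2 \<le> h y"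
      using \<open>e > 0\<close> by (auto simp: eventually_at_filter elim: eventually_mono)
    then obtain \<delta> where "\<delta> > 0" and \<delta>:
      "\<And>y. dist y x < \<delta> \<Longrightarrow> \<bar>u y - u x\<bar> \<le> (h x + e / 2) * \<bar>y - x\<bar> \<and> h x - e / 2 \<le> h y"
      by (auto simp: eventually_nhds_metric)
    have "\<bar>u d - u c\<bar> \<le> integral {c..d} h + e * (d - c)" if cd: "c \<le> x" "x \<le> d" "d - c < \<delta>" for c d
    proof -
      have "\<bar>u d - u c\<bar> \<le> (h x + e / 2) * (d - x) + (h x + e / 2) * (x - c)"
      proof -
        have "\<bar>u d - u x\<bar> \<le> (h x + e / 2) * (d - x)" "\<bar>u c - u x\<bar> \<le> (h x + e / 2) * (x - c)"
          using \<delta>[of c] \<delta>[of d] cd by (simp_all add: dist_real_def)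
        then show ?thesis by linarith
      qed
      also have "\<dots> = (h x - e / 2) * (d - c) + e * (d - c)"
        by (simp add: field_simps)
      also have "(h x - e / 2) * (d - c) = integral {c..d} (\<lambda>_. h x - e / 2)"
        using cd by simp
      also have "\<dots> \<le> integral {c..d} h"
        using cd by (intro integral_le int) (auto intro!: \<delta>[THEN conjunct2] simp: dist_real_def)
      finally show ?thesis by simp
    qed
    then show ?case
      using \<open>\<delta> > 0\<close> by blast
  qed
  note bound = this
  have "((\<lambda>e. integral {a..b} h + e * (b - a)) \<longlongrightarrow> integral {a..b} h + 0 * (b - a)) (at_right 0)"
    by (intro tendsto_intros)
  then have lim: "((\<lambda>e. integral {a..b} h + e * (b - a)) \<longlongrightarrow> integral {a..b} h) (at_right 0)"
    by simp
  show ?thesis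
    by (rule tendsto_lowerbound[OF lim eventually_mono[OF eventually_at_right_less]]) (use bound in auto)
qed

section \<open>The Sobolev inequality for functions with a slope bound\<close>

lemma line_eq: "b \<in> Basis \<Longrightarrow> line b x t = x + (t - x \<bullet> b) *\<^sub>R b"
  by (rule euclidean_eqI) (auto simp: slice_inner inner_simps inner_Basis)

lemma slope_le_line:
  fixes u :: "'a::euclidean_space \<Rightarrow> real"
  assumes b: "b \<in> Basis" and u: "slope_le u (line b x t) c"
  shows "slope_le (\<lambda>s. u (line b x s)) t c"
proof -
  obtain R where R: "(R \<longlongrightarrow> c) (at (line b x t))"
      "\<forall>\<^sub>F y in at (line b x t). \<bar>u y - u (line b x t)\<bar> \<le> R y * dist y (line b x t)"
    using u by (auto simp: slope_le_def)
  have dist: "dist (line b x s) (line b x t) = dist s t" for s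
    using b by (simp add: line_eq dist_norm scaleR_diff_left[symmetric])
  have lim: "filterlim (line b x) (at (line b x t)) (at t)"
  proof (rule filterlim_atI)
    show "(line b x \<longlongrightarrow> line b x t) (at t)"
      unfolding line_eq[OF b] by (intro tendsto_intros)
    show "\<forall>\<^sub>F s in at t. line b x s \<noteq> line b x t"
      unfolding eventually_at_filter by (rule always_eventually) (metis dist dist_eq_0_iff)
  qed
  show ?thesis
  proof (rule slope_leI)
    show "((\<lambda>s. R (line b x s)) \<longlongrightarrow> c) (at t)"
      by (rule filterlim_compose[OF R(1) lim])
    show "\<forall>\<^sub>F s in at t. \<bar>u (line b x s) - u (line b x t)\<bar> \<le> R (line b x s) * dist s t"
      using eventually_compose_filterlim[OF R(2) lim] by (simp add: dist)
  qed
qed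

text \<open>
  Starting from \<open>x\<close>, follow the coordinate line backwards until it has left the bounded set \<open>K\<close>, where \<open>u\<close>
  vanishes, and integrate the slope bound in between.
\<close>

lemma slope_le_imp_le_line_integral:
  fixes u h :: "'a::euclidean_space \<Rightarrow> real"
  assumes K: "compact K" and u0: "\<And>x. x \<notin> K \<Longrightarrow> u x = 0"
    and slope: "\<And>x. slope_le u x (h x)" and h: "continuous_on UNIV h" "\<And>x. h x \<ge> 0"
    and b: "b \<in> Basis"
  shows "ennreal \<bar>u x\<bar> \<le> (\<integral>\<^sup>+ t. ennreal (h (line b x t)) \<partial>lborel)"
proof -
  obtain B where B: "\<And>y. y \<in> K \<Longrightarrow> norm y \<le> B"
    using compact_imp_bounded[OF K] by (auto simp: bounded_iff)
  \<comment> \<open>A parameter before \<open>x\<close> whose modulus exceeds the norm bound \<open>B\<close> for \<open>K\<close>.\<close>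
  define s where "s = min (x \<bullet> b) (- \<bar>B\<bar> - 1)"
  have "line b x s \<notin> K"
  proof
    assume "line b x s \<in> K"
    from B[OF this] Basis_le_norm[OF b, of "line b x s"] b show False
      by (simp add: slice_inner s_def)
  qed
  then have us: "u (line b x s) = 0" by (rule u0)
  have ux: "line b x (x \<bullet> b) = x"
    using b by (simp add: line_eq)
  have cont: "continuous_on UNIV (\<lambda>t. h (line b x t))"
    unfolding line_eq[OF b] by (intro continuous_on_compose2[OF h(1)] continuous_intros) auto
  have "\<bar>u x\<bar> \<le> integral {s..x \<bullet> b} (\<lambda>t. h (line b x t))"
    using slope_le_imp_increment_le_integral[of "\<lambda>t. u (line b x t)", OF slope_le_line[OF b slope] cont,
        of s "x \<bullet> b"]
    by (simp add: us ux) (simp add: s_def)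
  also have "ennreal \<dots> = (\<integral>\<^sup>+ t. ennreal (indicator {s..x \<bullet> b} t * h (line b x t)) \<partial>lborel)"
  proof (rule sym, rule nn_integral_has_integral_lebesgue)
    show "((\<lambda>t. h (line b x t)) has_integral integral {s..x \<bullet> b} (\<lambda>t. h (line b x t))) {s..x \<bullet> b}"
      by (intro integrable_integral integrable_continuous_real continuous_on_subset[OF cont]) simp
  qed (use h in auto)
  also have "\<dots> \<le> (\<integral>\<^sup>+ t. ennreal (h (line b x t)) \<partial>lborel)"
    using h(2) by (intro nn_integral_mono) (auto simp: indicator_def)
  finally show ?thesis
    by (simp add: ennreal_leI)
qed

lemma integrable_continuous_compact_support:
  fixes f :: "'a::euclidean_space \<Rightarrow> real"
  assumes "compact K" "continuous_on K f" "\<And>x. x \<notin> K \<Longrightarrow> f x = 0"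
  shows "integrable lborel f"
proof -
  have "(\<lambda>x. indicator K x *\<^sub>R f x) = f"
    using assms(3) by (force simp: indicator_def)
  then show ?thesis
    using borel_integrable_compact[OF assms(1,2)] by simp
qed

text \<open>
  There are \<open>n\<close> coordinate lines through \<open>x\<close>, so \<open>\<bar>u x\<bar> powr (n / (n - 1))\<close> is the product of \<open>n\<close> copies of
  \<open>\<bar>u x\<bar> powr (1 / (n - 1))\<close>, each of them bounded by the line integral of \<open>h\<close> in a different direction.
\<close>

lemma Gagliardo_Nirenberg_Sobolev_1:
  fixes u h :: "'a::euclidean_space \<Rightarrow> real"
  defines "n \<equiv> real DIM('a)"
  assumes "n > 1" and K: "compact K" and u0: "\<And>x. x \<notin> K \<Longrightarrow> u x = 0" and h0: "\<And>x. x \<notin> K \<Longrightarrow> h x = 0"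
    and slope: "\<And>x. slope_le u x (h x)" and h: "continuous_on UNIV h" "\<And>x. h x \<ge> 0"
  shows "(\<integral>x. \<bar>u x\<bar> powr (n / (n - 1)) \<partial>lborel) \<le> (\<integral>x. h x \<partial>lborel) powr (n / (n - 1))"
proof -
  have "integrable lborel h"
    using K h h0 by (intro integrable_continuous_compact_support[of K]) (auto intro: continuous_on_subset)
  then have int: "(\<integral>\<^sup>+ x. ennreal (h x) \<partial>lborel) = ennreal (\<integral>x. h x \<partial>lborel)"
    using h by (intro nn_integral_eq_integral) auto
  have [measurable]: "h \<in> borel_measurable borel" 
    using h by (intro borel_measurable_continuous_onI)
  have "continuous_on UNIV u"
    using slope slope_le_imp_isCont by (blast intro: continuous_at_imp_continuous_on)
  then have [measurable]: "u \<in> borel_measurable borel" 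
    by (intro borel_measurable_continuous_onI)
  have "(\<integral>\<^sup>+ x. ennreal (\<bar>u x\<bar> powr (n / (n - 1))) \<partial>lborel)
      \<le> (\<integral>\<^sup>+ x. (\<Prod>b\<in>Basis. epow (\<integral>\<^sup>+ t. ennreal (h (line b x t)) \<partial>lborel) (1 / (n - 1))) \<partial>lborel)"
  proof (rule nn_integral_mono)
    fix x
    have "ennreal (\<bar>u x\<bar> powr (n / (n - 1))) = (\<Prod>b\<in>(Basis::'a set). epow (ennreal \<bar>u x\<bar>) (1 / (n - 1)))"
      using \<open>n > 1\<close>
      by (cases "u x = 0") (simp_all add: epow_ennreal ennreal_power powr_power n_def)
    also have "\<dots> \<le> (\<Prod>b\<in>Basis. epow (\<integral>\<^sup>+ t. ennreal (h (line b x t)) \<partial>lborel) (1 / (n - 1)))"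
      using \<open>n > 1\<close> slope_le_imp_le_line_integral[OF K u0 slope h]
      by (intro prod_mono_ennreal epow_mono) auto
    finally show "ennreal (\<bar>u x\<bar> powr (n / (n - 1)))
        \<le> (\<Prod>b\<in>Basis. epow (\<integral>\<^sup>+ t. ennreal (h (line b x t)) \<partial>lborel) (1 / (n - 1)))" .
  qed
  also have "\<dots> \<le> epow (\<integral>\<^sup>+ x. ennreal (h x) \<partial>lborel) (n / (n - 1))"
    using \<open>n > 1\<close> unfolding n_def by (intro Gagliardo) auto
  also have "\<dots> = ennreal ((\<integral>x. h x \<partial>lborel) powr (n / (n - 1)))"
    using \<open>n > 1\<close> h by (simp add: int epow_ennreal integral_nonneg_AE)
  finally show ?thesis
    by (subst integral_eq_nn_integral) (auto intro!: enn2real_leI)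
qed

text \<open>
  For \<open>p > 1\<close> apply the case \<open>p = 1\<close> to \<open>\<bar>u\<bar> powr \<gamma>\<close>, with \<open>\<gamma>\<close> chosen so that \<open>\<gamma> n / (n - 1)\<close> is the
  exponent \<open>r = n p / (n - p)\<close>. Its slope bound is \<open>\<gamma> * \<bar>u\<bar> powr (\<gamma> - 1) * h\<close>. Hoelder's inequality
  splits off the \<open>L\<^sup>p\<close> norm of \<open>h\<close> and leaves the factor \<open>S powr (1 - 1 / p)\<close>, where \<open>S\<close> is the
  integral of \<open>\<bar>u\<bar> powr r\<close>, because \<open>\<gamma> - 1 = r (1 - 1 / p)\<close>. As \<open>S\<close> is finite, this factor can be
  moved to the left-hand side, where \<open>S powr (1 / r)\<close> remains.
\<close>

lemma Gagliardo_Nirenberg_Sobolev: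
  fixes u h :: "'a::euclidean_space \<Rightarrow> real"
  defines "n \<equiv> real DIM('a)"
  assumes p: "1 \<le> p" "p < n" and K: "compact K"
    and u0: "\<And>x. x \<notin> K \<Longrightarrow> u x = 0" and h0: "\<And>x. x \<notin> K \<Longrightarrow> h x = 0"
    and slope: "\<And>x. slope_le u x (h x)" and h: "continuous_on UNIV h" "\<And>x. h x \<ge> 0"
  shows "(\<integral>x. \<bar>u x\<bar> powr (n * p / (n - p)) \<partial>lborel) powr (1 / (n * p / (n - p)))
      \<le> p * (n - 1) / (n - p) * (\<integral>x. h x powr p \<partial>lborel) powr (1 / p)"
proof (cases "p = 1")
  case True
  have "(\<integral>x. \<bar>u x\<bar> powr (n / (n - 1)) \<partial>lborel) powr (1 / (n / (n - 1)))
      \<le> ((\<integral>x. h x \<partial>lborel) powr (n / (n - 1))) powr (1 / (n / (n - 1)))"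
    using p True K u0 h0 slope h unfolding n_def
    by (intro powr_mono2 Gagliardo_Nirenberg_Sobolev_1[of K]) (auto simp: integral_nonneg_AE)
  also have "\<dots> = (\<integral>x. h x \<partial>lborel)"
    using p True h by (simp add: powr_powr integral_nonneg_AE)
  finally show ?thesis
    using p True h by (simp add: integral_nonneg_AE)
next
  case False
  with p have "p > 1" "n > 1" by auto
  define \<gamma> r where "\<gamma> = p * (n - 1) / (n - p)" and "r = n * p / (n - p)"
  have "\<gamma> > 1"
  proof -
    have "n - p < p * (n - 1)"
      using \<open>p > 1\<close> \<open>n > 1\<close> by (simp add: algebra_simps)
    then show ?thesis using p by (simp add: \<gamma>_def)
  qed
  have r: "\<gamma> * (n / (n - 1)) = r" "\<gamma> - 1 = r * (1 - 1 / p)" "(n - 1) / n - (1 - 1 / p) = 1 / r" "r > 0"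
  proof -
    have nz: "n - p \<noteq> 0" "n - 1 \<noteq> 0" "n \<noteq> 0" "p \<noteq> 0"
      using p \<open>n > 1\<close> by auto
    show "\<gamma> * (n / (n - 1)) = r"
      using nz by (simp add: \<gamma>_def r_def)
    have "\<gamma> - 1 = (p * (n - 1) - (n - p)) / (n - p)"
      using nz by (simp add: \<gamma>_def diff_divide_distrib)
    also have "p * (n - 1) - (n - p) = n * (p - 1)"
      by (simp add: algebra_simps)
    also have "n * (p - 1) / (n - p) = r * (1 - 1 / p)"
      using nz by (simp add: r_def right_diff_distrib diff_divide_distrib)
    finally show "\<gamma> - 1 = r * (1 - 1 / p)" .
    show "(n - 1) / n - (1 - 1 / p) = 1 / r" "r > 0"
      using nz p by (simp_all add: r_def diff_divide_distrib)
  qed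
  define w where "w x = \<bar>u x\<bar>" for x
  have w: "w x \<ge> 0" "slope_le w x (h x)" "isCont w x" for x
    using slope slope_le_imp_isCont[OF slope_le_abs[OF slope]] unfolding w_def by (auto intro: slope_le_abs)
  have contw: "continuous_on UNIV w"
    using w(3) by (blast intro: continuous_at_imp_continuous_on)
  have w0: "w x = 0" if "x \<notin> K" for x
    using u0[OF that] by (simp add: w_def)
  have intw: "integrable lborel (\<lambda>x. w x powr r)"
    using K contw w r(4) w0
    by (intro integrable_continuous_compact_support[of K] continuous_on_powr')
       (auto intro: continuous_on_subset)
  have inth: "integrable lborel (\<lambda>x. h x powr p)"
    using K h h0 p
    by (intro integrable_continuous_compact_support[of K] continuous_on_powr')
       (auto intro: continuous_on_subset)
  define S H where "S = (\<integral>x. w x powr r \<partial>lborel)" and "H = (\<integral>x. h x powr p \<partial>lborel)"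
  have S0: "S \<ge> 0" "H \<ge> 0" by (auto simp: S_def H_def integral_nonneg_AE)
  have "(\<integral>x. \<bar>w x powr \<gamma>\<bar> powr (n / (n - 1)) \<partial>lborel)
      \<le> (\<integral>x. \<gamma> * w x powr (\<gamma> - 1) * h x \<partial>lborel) powr (n / (n - 1))"
    unfolding n_def
  proof (rule Gagliardo_Nirenberg_Sobolev_1[OF _ K])
    show "slope_le (\<lambda>x. w x powr \<gamma>) x (\<gamma> * w x powr (\<gamma> - 1) * h x)" for x
      using w \<open>\<gamma> > 1\<close> by (intro slope_le_powr)
    show "continuous_on UNIV (\<lambda>x. \<gamma> * w x powr (\<gamma> - 1) * h x)"
      using w \<open>\<gamma> > 1\<close> by (intro continuous_intros contw h continuous_on_powr') auto
  qed (use \<open>n > 1\<close> \<open>\<gamma> > 1\<close> w0 h h0 in \<open>auto simp: n_def\<close>)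
  also have "(\<integral>x. \<bar>w x powr \<gamma>\<bar> powr (n / (n - 1)) \<partial>lborel) = S"
    by (simp add: S_def powr_powr r(1) del: times_divide_eq_right)
  also have "(\<integral>x. \<gamma> * w x powr (\<gamma> - 1) * h x \<partial>lborel)
      = \<gamma> * (\<integral>x. (w x powr r) powr (1 - 1 / p) * (h x powr p) powr (1 / p) \<partial>lborel)"
    using p h by (simp add: powr_powr r mult.assoc)
  finally have "S \<le> (\<gamma> * (\<integral>x. (w x powr r) powr (1 - 1 / p) * (h x powr p) powr (1 / p) \<partial>lborel)) powr (n / (n - 1))" .
  also have "\<dots> \<le> (\<gamma> * (S powr (1 - 1 / p) * H powr (1 / p))) powr (n / (n - 1))"
    unfolding S_def H_def using \<open>p > 1\<close> \<open>n > 1\<close> \<open>\<gamma> > 1\<close>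
    by (intro powr_mono2 mult_left_mono integral_Holder intw inth) (auto simp: integral_nonneg_AE)
  finally have S: "S \<le> (\<gamma> * (S powr (1 - 1 / p) * H powr (1 / p))) powr (n / (n - 1))" .
  have "S powr (1 / r) \<le> \<gamma> * H powr (1 / p)"
  proof (cases "S = 0")
    case True
    then show ?thesis using \<open>\<gamma> > 1\<close> by simp
  next
    case False
    with S0 have "S > 0" by simp
    \<comment> \<open>Dividing by \<open>S powr (1 - 1 / p)\<close> leaves the exponent \<open>(n - 1) / n - (1 - 1 / p) = 1 / r\<close>.\<close>
    have "S powr ((n - 1) / n) \<le> ((\<gamma> * (S powr (1 - 1 / p) * H powr (1 / p))) powr (n / (n - 1))) powr ((n - 1) / n)"
      using S S0 \<open>n > 1\<close> by (intro powr_mono2) auto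
    also have "\<dots> = \<gamma> * (S powr (1 - 1 / p) * H powr (1 / p))"
      using \<open>n > 1\<close> \<open>\<gamma> > 1\<close> by (simp add: powr_powr)
    finally have "S powr ((n - 1) / n) / S powr (1 - 1 / p) \<le> \<gamma> * H powr (1 / p)"
      using \<open>S > 0\<close> by (simp add: divide_simps mult_ac)
    then show ?thesis
      by (simp add: powr_diff[symmetric] r(3))
  qed
  then show ?thesis
    by (simp add: S_def H_def \<gamma>_def r_def w_def)
qed

section \<open>Test functions and the distance to the boundary\<close>

lemma test_function_frechet_derivative:
  fixes f :: "real ^ 'n::finite \<Rightarrow> real"
  assumes f: "f \<in> test_functions G"
  shows "(f has_derivative (\<lambda>v. gradient f x \<bullet> v)) (at x)"
proof -
  have "C_k (Suc 0) f"
    using f unfolding test_functions_def by blast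
  then have "f differentiable (at x)"
    by (simp add: differentiable_on_def)
  then have D: "(f has_derivative frechet_derivative f (at x)) (at x)"
    by (simp add: frechet_derivative_works)
  have lin: "linear (frechet_derivative f (at x))"
    using has_derivative_linear[OF D] .
  have "frechet_derivative f (at x) v = gradient f x \<bullet> v" for v
  proof -
    have "frechet_derivative f (at x) v = frechet_derivative f (at x) (\<Sum>i\<in>UNIV. v $ i *\<^sub>R axis i 1)"
      by (simp add: basis_expansion scalar_mult_eq_scaleR[symmetric])
    also have "\<dots> = (\<Sum>i\<in>UNIV. v $ i * frechet_derivative f (at x) (axis i 1))"
      by (simp add: linear_sum[OF lin] linear_cmul[OF lin])
    also have "\<dots> = gradient f x \<bullet> v"
      by (simp add: inner_vec_def gradient_def partial_deriv_def mult.commute)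
    finally show ?thesis .
  qed
  then have "frechet_derivative f (at x) = (\<lambda>v. gradient f x \<bullet> v)" by auto
  with D show ?thesis by simp
qed

lemma test_function_continuous_gradient:
  fixes f :: "real ^ 'n::finite \<Rightarrow> real"
  assumes f: "f \<in> test_functions G"
  shows "continuous_on UNIV (gradient f)"
proof -
  have "C_k (Suc 0) f"
    using f unfolding test_functions_def by blast
  then have "continuous_on UNIV (partial_deriv i f)" for i
    by simp
  then have "continuous_on UNIV (\<lambda>x. \<chi> i. partial_deriv i f x)"
    by (intro continuous_on_vec_lambda) 
  then show ?thesis
    unfolding gradient_def[abs_def] .
qed

lemma bdist_pos:
  assumes "open G" "frontier G \<noteq> {}" "x \<in> G"
  shows "bdist G x > 0"
proof -
  have "x \<notin> frontier G"
    using assms by (simp add: frontier_def interior_open)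
  then show ?thesis
    using assms infdist_pos_not_in_closed[OF frontier_closed] by (simp add: bdist_def)
qed

text \<open>
  The distance to a set is 1-Lipschitz, and \<open>t powr s\<close> is differentiable at \<open>t > 0\<close>.
\<close>

lemma slope_le_bdist_powr:
  assumes G: "open G" "frontier G \<noteq> {}" "x \<in> G"
  shows "slope_le (\<lambda>y. bdist G y powr s) x (\<bar>s\<bar> * bdist G x powr (s - 1))"
proof -
  have "slope_le (bdist G) x 1"
  proof (rule slope_le_Lipschitz)
    show "\<bar>bdist G y - bdist G x\<bar> \<le> 1 * dist y x" for y
      using infdist_triangle_abs[of y "frontier G" x] by (simp add: bdist_def)
  qed
  from slope_le_compose_DERIV[OF this has_real_derivative_powr[OF bdist_pos[OF G], of s]]
  show ?thesis by (simp add: abs_mult)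
qed

text \<open>
  On the compact set \<open>K\<close> the distance to the boundary is continuous and positive, so any real exponent
  \<open>e\<close> is harmless; outside \<open>K\<close> the integrand vanishes.
\<close>

lemma set_integrable_powr_bdist:
  fixes g :: "real ^ 'n::finite \<Rightarrow> real"
  assumes G: "open G" "frontier G \<noteq> {}" and K: "compact K" "K \<subseteq> G"
    and g: "continuous_on UNIV g" "\<And>x. x \<notin> K \<Longrightarrow> g x = 0" "\<And>x. g x \<ge> 0" and "q > 0"
  shows "set_integrable lborel G (\<lambda>x. g x powr q * bdist G x powr e)"
  unfolding set_integrable_def
proof (rule integrable_continuous_compact_support[OF K(1)])
  have pos: "bdist G x > 0" if "x \<in> K" for x
    using bdist_pos[OF G] K that by blast
  have "continuous_on K (\<lambda>x. g x powr q * bdist G x powr e)"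
    unfolding bdist_def using \<open>q > 0\<close> g pos
    by (intro continuous_intros continuous_on_powr' continuous_on_subset[OF g(1)])
       (force simp: bdist_def)+
  then show "continuous_on K (\<lambda>x. indicat_real G x *\<^sub>R (g x powr q * bdist G x powr e))"
    by (rule continuous_on_eq) (use K in auto)
qed (use g in auto)

section \<open>Interpolation in the exponent\<close>

text \<open>
  Write \<open>q = (1 - t) q0 + t q1\<close>. Both exponents in the integrand are affine in \<open>q\<close>, so the integrand for
  \<open>q\<close> is the product of those for \<open>q0\<close> and \<open>q1\<close> to the powers \<open>1 - t\<close> and \<open>t\<close>, and Hoelder's
  inequality applies. If the two integrals are at most \<open>(D N)\<^bsup>q0\<^esup>\<close> and \<open>(D N)\<^bsup>q1\<^esup>\<close>, with \<open>D\<close> the larger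
  of the two constants, the bound that results is \<open>(D N)\<^bsup>q\<^esup>\<close>.
\<close>

lemma hardy_sobolev_interpolation:
  fixes G :: "(real ^ 'n::finite) set"
  assumes G: "open G" "frontier G \<noteq> {}" and q: "0 < q0" "q0 \<le> q" "q \<le> q1"
    and H0: "hardy_sobolev G q0 p \<beta>" and H1: "hardy_sobolev G q1 p \<beta>"
  shows "hardy_sobolev G q p \<beta>"
proof (cases "q = q0 \<or> q = q1")
  case True
  then show ?thesis using H0 H1 by auto
next
  case False
  with q have q': "0 < q" "0 < q1" "q0 < q" "q < q1" by auto
  define e where "e r = (r / p) * (real CARD('n) - p + \<beta>) - real CARD('n)" for r
  define I where "I f r = (LINT x:G|lborel. \<bar>f x\<bar> powr r * bdist G x powr e r)" for f :: "real ^ 'n \<Rightarrow> real" and r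
  define N where "N f = (LINT x:G|lborel. norm (gradient f x) powr p * bdist G x powr \<beta>) powr (1 / p)"
    for f :: "real ^ 'n \<Rightarrow> real"
  obtain C0 where C0: "C0 > 0" "\<And>f. f \<in> test_functions G \<Longrightarrow> I f q0 powr (1 / q0) \<le> C0 * N f"
    using H0 unfolding hardy_sobolev_def I_def N_def e_def by auto
  obtain C1 where C1: "C1 > 0" "\<And>f. f \<in> test_functions G \<Longrightarrow> I f q1 powr (1 / q1) \<le> C1 * N f"
    using H1 unfolding hardy_sobolev_def I_def N_def e_def by auto
  define D where "D = max C0 C1"
  have D: "D > 0" "C0 \<le> D" "C1 \<le> D"
    using C0 by (auto simp: D_def)
  define t where "t = (q - q0) / (q1 - q0)"
  have t: "t > 0" "1 - t > 0" "q0 * (1 - t) + q1 * t = q"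
  proof -
    show "t > 0" "1 - t > 0"
      using q' by (auto simp: t_def divide_simps)
    have "q0 * (1 - t) + q1 * t = q0 + t * (q1 - q0)" by (simp add: algebra_simps)
    then show "q0 * (1 - t) + q1 * t = q" using q' by (simp add: t_def)
  qed
  have et: "e q0 * (1 - t) + e q1 * t = e q"
    unfolding e_def t(3)[symmetric] by (simp add: algebra_simps add_divide_distrib diff_divide_distrib)
  have "I f q powr (1 / q) \<le> D * N f" if f: "f \<in> test_functions G" for f
  proof -
    define K where "K = closure {x. f x \<noteq> 0}"
    have K: "compact K" "K \<subseteq> G"
      using f by (auto simp: K_def test_functions_def)
    have f0: "f x = 0" if "x \<notin> K" for x
      using that closure_subset[of "{x. f x \<noteq> 0}"] by (auto simp: K_def)
    have "continuous_on UNIV f"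
      using has_derivative_continuous[OF test_function_frechet_derivative[OF f]]
      by (blast intro: continuous_at_imp_continuous_on)
    then have int: "set_integrable lborel G (\<lambda>x. \<bar>f x\<bar> powr r * bdist G x powr e r)" if "r > 0" for r
      using that f0 by (intro set_integrable_powr_bdist[OF G K] continuous_intros) auto
    define F where "F r x = indicat_real G x * (\<bar>f x\<bar> powr r * bdist G x powr e r)" for r x
    have F: "integrable lborel (F r)" "\<And>x. F r x \<ge> 0" if "r > 0" for r
      using int[OF that] by (auto simp: F_def[abs_def] set_integrable_def)
    have I_eq: "I f r = (\<integral>x. F r x \<partial>lborel)" for r
      by (simp add: I_def F_def set_lebesgue_integral_def)
    have nonneg: "I f r \<ge> 0" for r
      unfolding I_eq by (intro integral_nonneg_AE) (auto simp: F_def)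
    have le: "I f r \<le> (D * N f) powr r" if "I f r powr (1 / r) \<le> C * N f" "C \<le> D" "r > 0" for r C
    proof -
      have "N f \<ge> 0" by (simp add: N_def)
      then have "I f r powr (1 / r) \<le> D * N f"
        using that by (meson mult_right_mono order_trans)
      then have "(I f r powr (1 / r)) powr r \<le> (D * N f) powr r"
        using that by (intro powr_mono2) auto
      then show ?thesis
        using nonneg[of r] that by (simp add: powr_powr)
    qed
    have F_split: "F q x = F q0 x powr (1 - t) * F q1 x powr t" for x
    proof (cases "x \<in> G \<and> f x \<noteq> 0")
      case True
      then have "bdist G x > 0" using bdist_pos[OF G] by blast
      have "F q0 x powr (1 - t) * F q1 x powr t
          = \<bar>f x\<bar> powr (q0 * (1 - t) + q1 * t) * bdist G x powr (e q0 * (1 - t) + e q1 * t)"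
        using True \<open>bdist G x > 0\<close> by (simp add: F_def powr_mult powr_powr powr_add)
      then show ?thesis
        using True by (simp add: t et F_def)
    qed (auto simp: F_def)
    have "I f q = (\<integral>x. F q0 x powr (1 - t) * F q1 x powr t \<partial>lborel)"
      unfolding I_eq F_split[abs_def] ..
    also have "\<dots> \<le> I f q0 powr (1 - t) * I f q1 powr t"
      unfolding I_eq using q q' t by (intro integral_Holder F) auto
    also have "\<dots> \<le> ((D * N f) powr q0) powr (1 - t) * ((D * N f) powr q1) powr t"
      using le[OF C0(2)[OF f] D(2)] le[OF C1(2)[OF f] D(3)] nonneg q q' t
      by (intro mult_mono powr_mono2) auto
    also have "\<dots> = (D * N f) powr q"
      by (simp add: powr_powr powr_add[symmetric] t)
    finally have "I f q powr (1 / q) \<le> ((D * N f) powr q) powr (1 / q)"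
      using nonneg q' by (intro powr_mono2) auto
    also have "\<dots> = D * N f"
      using D q' by (simp add: powr_powr N_def)
    finally show ?thesis .
  qed
  then show ?thesis
    using D(1) unfolding hardy_sobolev_def I_def N_def e_def by blast
qed

section \<open>From the Hardy inequality to the critical exponent\<close>

lemma powr_add_le:
  fixes a b p :: real
  assumes "a \<ge> 0" "b \<ge> 0" "p \<ge> 0"
  shows "(a + b) powr p \<le> 2 powr p * (a powr p + b powr p)"
proof -
  have "(a + b) powr p \<le> (2 * max a b) powr p"
    using assms by (intro powr_mono2) auto
  also have "\<dots> = 2 powr p * max a b powr p"
    using assms by (simp add: powr_mult)
  also have "max a b powr p \<le> a powr p + b powr p"
    by (auto simp: max_def)
  finally show ?thesis by simp
qed

text \<open>
  The Sobolev inequality for \<open>u = \<bar>f\<bar> d\<^bsup>s\<^esup>\<close> with \<open>s = \<beta> / p\<close>. The Hardy inequality enters only in the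
  bound on the integral \<open>P\<close> of the term in which the derivative falls on the weight \<open>d\<^bsup>s\<^esup>\<close>; the identity
  \<open>(s - 1) p = \<beta> - p\<close> makes that term the left-hand side of the Hardy inequality.
\<close>

lemma hardy_sobolev_critical:
  fixes G :: "(real ^ 'n::finite) set" and p \<beta> :: real
  defines "n \<equiv> real CARD('n)"
  assumes G: "open G" "frontier G \<noteq> {}" and p: "1 \<le> p" "p < n"
    and H: "hardy_sobolev G p p \<beta>"
  shows "hardy_sobolev G (n * p / (n - p)) p \<beta>"
proof -
  define r s where "r = n * p / (n - p)" and "s = \<beta> / p"
  have exps: "r / p * (n - p + \<beta>) - n = s * r" "(s - 1) * p = \<beta> - p" "s * p = \<beta>" "r > 0"
  proof -
    have nz: "n - p \<noteq> 0" "p \<noteq> 0" using p by auto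
    have "r / p * (n - p + \<beta>) - n = n * (n - p + \<beta>) / (n - p) - n * (n - p) / (n - p)"
      using nz by (simp add: r_def)
    also have "\<dots> = n * \<beta> / (n - p)"
      unfolding diff_divide_distrib[symmetric] by (simp add: algebra_simps)
    also have "\<dots> = s * r" using nz by (simp add: r_def s_def)
    finally show "r / p * (n - p + \<beta>) - n = s * r" .
    show "(s - 1) * p = \<beta> - p" "s * p = \<beta>" "r > 0"
      using nz p by (auto simp: s_def r_def left_diff_distrib)
  qed
  define \<gamma> where "\<gamma> = p * (n - 1) / (n - p)"
  have "\<gamma> > 0" using p by (simp add: \<gamma>_def)
  define N where "N f = (LINT x:G|lborel. norm (gradient f x) powr p * bdist G x powr \<beta>)"
    for f :: "real ^ 'n \<Rightarrow> real"
  obtain C where "C > 0" and C: "\<And>f. f \<in> test_functions G \<Longrightarrow>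
      (LINT x:G|lborel. \<bar>f x\<bar> powr p * bdist G x powr (\<beta> - p)) powr (1 / p) \<le> C * N f powr (1 / p)"
    using H p unfolding hardy_sobolev_def N_def n_def[symmetric] by auto
  \<comment> \<open>The constants: \<open>A\<close> bounds the integral of \<open>h powr p\<close>, and \<open>\<gamma>\<close> comes from the Sobolev inequality.\<close>
  define A where "A = 2 powr p * (\<bar>s\<bar> powr p * C powr p + 1)"
  have "A > 0" by (simp add: A_def add_nonneg_pos)
  define D where "D = \<gamma> * A powr (1 / p)"
  have "D > 0" using \<open>A > 0\<close> \<open>\<gamma> > 0\<close> by (simp add: D_def)
  have "(LINT x:G|lborel. \<bar>f x\<bar> powr r * bdist G x powr (r / p * (n - p + \<beta>) - n)) powr (1 / r)
      \<le> D * N f powr (1 / p)" if f: "f \<in> test_functions G" for f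
  proof -
    define K where "K = closure {x. f x \<noteq> 0}"
    have K: "compact K" "K \<subseteq> G"
      using f by (auto simp: K_def test_functions_def)
    have f0: "f x = 0" if "x \<notin> K" for x
      using that closure_subset[of "{x. f x \<noteq> 0}"] by (auto simp: K_def)
    have near0: "\<forall>\<^sub>F y in nhds x. y \<notin> K" if "x \<notin> K" for x
      using that K(1) compact_imp_closed by (intro eventually_nhds_in_open[of "- K", simplified]) auto
    have Df: "(f has_derivative (\<lambda>v. gradient f x \<bullet> v)) (at x)" for x
      by (rule test_function_frechet_derivative[OF f])
    have contf: "continuous_on UNIV f"
      using has_derivative_continuous[OF Df] by (blast intro: continuous_at_imp_continuous_on)
    have contg: "continuous_on UNIV (gradient f)"
      by (rule test_function_continuous_gradient[OF f])
    have g0: "gradient f x = 0" if "x \<notin> K" for x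
    proof -
      have "(f has_derivative (\<lambda>v. 0)) (at x)"
        using near0[OF that] f0
        by (intro has_derivative_transform_eventually[OF has_derivative_const[of 0]])
           (auto simp: eventually_at_filter that elim: eventually_mono)
      from has_derivative_unique[OF Df this] have "gradient f x \<bullet> gradient f x = 0"
        by (rule fun_cong)
      then show ?thesis by simp
    qed
    define u where "u x = \<bar>f x\<bar> * bdist G x powr s" for x
    define h where "h x = \<bar>f x\<bar> * (\<bar>s\<bar> * bdist G x powr (s - 1)) + bdist G x powr s * norm (gradient f x)" for x
    have u0: "u x = 0" and h0: "h x = 0" if "x \<notin> K" for x
      using f0[OF that] g0[OF that] by (auto simp: u_def h_def)
    have h_nonneg: "h x \<ge> 0" for x
      by (simp add: h_def)
    have slope: "slope_le u x (h x)" for x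
    proof (cases "x \<in> K")
      case True
      then have "x \<in> G" using K by auto
      have "slope_le (\<lambda>y. \<bar>f y\<bar>) x (norm (gradient f x))"
        by (intro slope_le_abs slope_le_has_derivative[OF Df] Cauchy_Schwarz_ineq2)
      from slope_le_mult[OF this slope_le_bdist_powr[OF G \<open>x \<in> G\<close>]]
      show ?thesis by (simp add: u_def[abs_def] h_def)
    next
      case False
      have "slope_le u x 0"
        using near0[OF False] by (intro slope_le_locally_0) (auto elim: eventually_mono simp: u0)
      then show ?thesis by (simp add: h0 False)
    qed
    have conth: "continuous_on UNIV h"
    proof (rule continuous_at_imp_continuous_on, rule ballI)
      fix x show "isCont h x"
      proof (cases "x \<in> K")
        case True
        then have "bdist G x \<noteq> 0" using bdist_pos[OF G, of x] K by auto
        moreover have "isCont (bdist G) x"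
          unfolding bdist_def[abs_def] by (intro continuous_intros)
        ultimately show ?thesis
          using contf contg unfolding h_def[abs_def]
          by (intro continuous_intros) (auto simp: continuous_on_eq_continuous_at)
      next
        case False
        then show ?thesis
          using near0[OF False] h0
          by (subst isCont_cong[of _ "\<lambda>_. 0"]) (auto elim: eventually_mono)
      qed
    qed
    have int_f: "set_integrable lborel G (\<lambda>x. \<bar>f x\<bar> powr p * bdist G x powr (\<beta> - p))"
      using p f0 contf by (intro set_integrable_powr_bdist[OF G K] continuous_intros) auto
    have int_g: "set_integrable lborel G (\<lambda>x. norm (gradient f x) powr p * bdist G x powr \<beta>)"
      using p g0 contg by (intro set_integrable_powr_bdist[OF G K] continuous_intros) auto
    define P where "P = (LINT x:G|lborel. \<bar>f x\<bar> powr p * bdist G x powr (\<beta> - p))"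
    have nonneg: "P \<ge> 0" "N f \<ge> 0"
      unfolding P_def N_def set_lebesgue_integral_def by (intro integral_nonneg_AE; simp)+
    have "P = (P powr (1 / p)) powr p"
      using nonneg p by (simp add: powr_powr)
    also have "\<dots> \<le> (C * N f powr (1 / p)) powr p"
      using C[OF f] p unfolding P_def by (intro powr_mono2) auto
    also have "\<dots> = C powr p * N f"
      using p \<open>C > 0\<close> nonneg by (simp add: powr_mult powr_powr)
    finally have P: "P \<le> C powr p * N f" .
    have h_le: "h x powr p \<le> 2 powr p * (\<bar>s\<bar> powr p * (indicat_real G x *\<^sub>R (\<bar>f x\<bar> powr p * bdist G x powr (\<beta> - p)))
        + indicat_real G x *\<^sub>R (norm (gradient f x) powr p * bdist G x powr \<beta>))" for x
    proof (cases "x \<in> K")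
      case True
      then have "x \<in> G" using K by auto
      have "h x powr p \<le> 2 powr p * ((\<bar>f x\<bar> * (\<bar>s\<bar> * bdist G x powr (s - 1))) powr p
          + (bdist G x powr s * norm (gradient f x)) powr p)"
        unfolding h_def using p by (intro powr_add_le) auto
      then show ?thesis
        using \<open>x \<in> G\<close> exps by (simp add: powr_mult powr_powr mult_ac)
    next
      case False
      then show ?thesis using p by (simp add: h0 f0 g0)
    qed
    have "(\<integral>x. h x powr p \<partial>lborel) \<le> (\<integral>x. 2 powr p * (\<bar>s\<bar> powr p * (indicat_real G x *\<^sub>R (\<bar>f x\<bar> powr p * bdist G x powr (\<beta> - p)))
        + indicat_real G x *\<^sub>R (norm (gradient f x) powr p * bdist G x powr \<beta>)) \<partial>lborel)"
    proof (rule integral_mono)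
      show "integrable lborel (\<lambda>x. h x powr p)"
        using K h0 h_nonneg p conth
        by (intro integrable_continuous_compact_support[of K] continuous_on_powr')
           (auto intro: continuous_on_subset)
    qed (use int_f int_g h_le in \<open>auto simp: set_integrable_def\<close>)
    also have "\<dots> = 2 powr p * (\<bar>s\<bar> powr p * P + N f)"
      using int_f int_g unfolding set_integrable_def P_def N_def set_lebesgue_integral_def
      by (simp only: integral_mult_right_zero Bochner_Integration.integral_add integrable_mult_right)
    also have "\<dots> \<le> 2 powr p * (\<bar>s\<bar> powr p * (C powr p * N f) + N f)"
      using P by (intro mult_left_mono add_right_mono) auto
    also have "\<dots> = A * N f"
      by (simp add: A_def algebra_simps)
    finally have hA: "(\<integral>x. h x powr p \<partial>lborel) \<le> A * N f" .
    have "(LINT x:G|lborel. \<bar>f x\<bar> powr r * bdist G x powr (r / p * (n - p + \<beta>) - n)) = (\<integral>x. \<bar>u x\<bar> powr r \<partial>lborel)"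
      unfolding set_lebesgue_integral_def exps
    proof (intro Bochner_Integration.integral_cong refl)
      fix x
      show "indicat_real G x *\<^sub>R (\<bar>f x\<bar> powr r * bdist G x powr (s * r)) = \<bar>u x\<bar> powr r"
      proof (cases "x \<in> K")
        case True
        then show ?thesis using K by (auto simp: u_def powr_mult powr_powr abs_mult)
      next
        case False
        then show ?thesis by (simp add: u0 f0)
      qed
    qed
    also have "\<dots> powr (1 / r) \<le> \<gamma> * (\<integral>x. h x powr p \<partial>lborel) powr (1 / p)"
      using Gagliardo_Nirenberg_Sobolev[where u = u and h = h, OF p(1) _ K(1) u0 h0 slope conth h_nonneg] p
      by (simp add: r_def \<gamma>_def n_def)
    also have "\<dots> \<le> \<gamma> * (A * N f) powr (1 / p)"
      using hA p \<open>\<gamma> > 0\<close> by (intro mult_left_mono powr_mono2) (auto simp: integral_nonneg_AE)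
    also have "\<dots> = D * N f powr (1 / p)"
      using \<open>A > 0\<close> nonneg by (simp add: D_def powr_mult)
    finally show ?thesis .
  qed
  then show ?thesis
    using \<open>D > 0\<close> unfolding hardy_sobolev_def r_def[symmetric] n_def[symmetric] N_def by blast
qed

theorem theorem2p1:
  fixes G :: "(real ^ 'n::finite) set" and p \<beta> :: real
  assumes "CARD('n) \<ge> 2"
    and "open G" and "G \<noteq> {}" and "frontier G \<noteq> {}"
    and "1 \<le> p" and "p < real CARD('n)"
    and "hardy_sobolev G p p \<beta>"
  shows "\<forall>q. p \<le> q \<and> q \<le> real CARD('n) * p / (real CARD('n) - p) \<longrightarrow> hardy_sobolev G q p \<beta>"
  using assms hardy_sobolev_interpolation[of G p _ "real CARD('n) * p / (real CARD('n) - p)" p \<beta>]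
    hardy_sobolev_critical[of G p \<beta>]
  by auto

end
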